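(* Let $C$ be an even self-dual $L$-code of length $n$. Then there is a polynomial $F(X_1,X_2,X_3)$, weighted homogeneous of weighted degree $n$ with respect to the weights $1,2,3$ of $X_1,X_2,X_3$, such that $$\mathrm{swe}_C(x,y,z)=F\bigl(x+z,\ x^2+y^2+2z^2,\ x^3+3xz^2+3y^2z+z^3\bigr).$$
   Context: Let $L=\{0,1,\omega,\bar\omega\}$ be the Klein four-group $\mathbf{Z}_2\times\mathbf{Z}_2$. Define $|0|^2=0$, $|1|^2=1$, $|\omega|^2=|\bar\omega|^2=2$, $q(x)=|x|^2\bmod 2$, and the dot product $x\cdot y=q(x+y)-q(x)-q(y)\in\mathbf{F}_2$ (so $x\cdot y=1$ iff $x,y$ are distinct and nonzero). On $L^n$: $(\mathbf{x},\mathbf{y})=\sum_i x_i\cdot y_i$ and $\mathrm{ewt}(\mathbf{x})=\sum_i|x_i|^2$. An $L$-code of length $n$ is a subgroup $C\subseteq L^n$; it is self-dual if $C=\{\mathbf{x}:(\mathbf{x},\mathbf{y})=0\ \forall\mathbf{y}\in C\}$ and even if all codewords have even Euclidean weight. The symmetrized weight enumerator is $\mathrm{swe}_C(x,y,z)=\sum_{\mathbf{c}\in C}x^{n_0(\mathbf{c})}y^{n_1(\mathbf{c})}z^{n_2(\mathbf{c})}$, with $n_0,n_1,n_2$ the numbers of coordinates equal to $0$, to $1$, and to $\omega$ or $\bar\omega$. *)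

theory Defs
  imports
    "HOL-Analysis.Finite_Cartesian_Product"
    "HOL-Library.Product_Plus"
    "HOL-Library.Z2"
    "HOL-Library.Poly_Mapping"
begin

instance bit :: finite
proof
  have "(UNIV :: bit set) \<subseteq> {0, 1}"
    by (auto intro: bit.exhaust)
  then show "finite (UNIV :: bit set)"
    by (rule finite_subset) simp
qed

text \<open>
  The group structure is the componentwise one, so the neutral element is \<open>0 = (0, 0)\<close>.
  The nonzero elements are interchangeable under group automorphisms; with the labelling
  below one gets \<open>qf (a, b) = a * b\<close>.
\<close>

type_synonym klein = "bit \<times> bit"

definition kone :: klein where "kone = (1, 1)"
definition komega :: klein where "komega = (1, 0)"
definition komegabar :: klein where "komegabar = (0, 1)"

definition norm2 :: "klein \<Rightarrow> nat" where
  "norm2 x = (if x = 0 then 0 else if x = kone then 1 else 2)"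

text \<open>\<open>of_nat :: nat \<Rightarrow> bit\<close> is reduction modulo 2.\<close>

definition qf :: "klein \<Rightarrow> bit" where
  "qf x = of_nat (norm2 x)"

definition kdot :: "klein \<Rightarrow> klein \<Rightarrow> bit" where
  "kdot x y = qf (x + y) - qf x - qf y"

definition ip :: "klein ^ 'n \<Rightarrow> klein ^ 'n \<Rightarrow> bit" where
  "ip x y = (\<Sum>i\<in>UNIV. kdot (x $ i) (y $ i))"

definition ewt :: "klein ^ 'n \<Rightarrow> nat" where
  "ewt x = (\<Sum>i\<in>UNIV. norm2 (x $ i))"

definition L_code :: "(klein ^ 'n) set \<Rightarrow> bool" where
  "L_code C \<longleftrightarrow> 0 \<in> C \<and> (\<forall>x\<in>C. \<forall>y\<in>C. x + y \<in> C) \<and> (\<forall>x\<in>C. - x \<in> C)"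

definition self_dual :: "(klein ^ 'n) set \<Rightarrow> bool" where
  "self_dual C \<longleftrightarrow> C = {x. \<forall>y\<in>C. ip x y = 0}"

definition even_code :: "(klein ^ 'n) set \<Rightarrow> bool" where
  "even_code C \<longleftrightarrow> (\<forall>x\<in>C. even (ewt x))"

definition n0 :: "klein ^ 'n \<Rightarrow> nat" where
  "n0 c = card {i. c $ i = 0}"

definition n1 :: "klein ^ 'n \<Rightarrow> nat" where
  "n1 c = card {i. c $ i = kone}"

definition n2 :: "klein ^ 'n \<Rightarrow> nat" where
  "n2 c = card {i. c $ i = komega \<or> c $ i = komegabar}"

text \<open>
  The monoid ring of \<open>\<nat>\<^sup>3\<close> over the rationals: \<open>F\<close> has coefficient \<open>lookup F (i, j, k)\<close> at
  the monomial with exponents \<open>(i, j, k)\<close>.  Rational rather than integral coefficients are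
  needed: for some codes of length 4 the representing polynomial has denominator 3.
\<close>

type_synonym poly3 = "(nat \<times> nat \<times> nat) \<Rightarrow>\<^sub>0 rat"

definition pconst :: "rat \<Rightarrow> poly3" where "pconst a = Poly_Mapping.single 0 a"
definition var1 :: poly3 where "var1 = Poly_Mapping.single (1, 0, 0) 1"
definition var2 :: poly3 where "var2 = Poly_Mapping.single (0, 1, 0) 1"
definition var3 :: poly3 where "var3 = Poly_Mapping.single (0, 0, 1) 1"

definition poly3_subst :: "poly3 \<Rightarrow> poly3 \<Rightarrow> poly3 \<Rightarrow> poly3 \<Rightarrow> poly3" where
  "poly3_subst F p q r =
     (\<Sum>(i, j, k)\<in>Poly_Mapping.keys F.
        pconst (Poly_Mapping.lookup F (i, j, k)) * p ^ i * q ^ j * r ^ k)"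

definition weighted_homogeneous :: "nat \<Rightarrow> nat \<Rightarrow> nat \<Rightarrow> nat \<Rightarrow> poly3 \<Rightarrow> bool" where
  "weighted_homogeneous w1 w2 w3 d F \<longleftrightarrow>
     (\<forall>(i, j, k)\<in>Poly_Mapping.keys F. w1 * i + w2 * j + w3 * k = d)"

definition swe :: "(klein ^ 'n) set \<Rightarrow> poly3" where
  "swe C = (\<Sum>c\<in>C. var1 ^ n0 c * var2 ^ n1 c * var3 ^ n2 c)"

end

theory Submission
  imports Defs
begin

text \<open>
  The MacWilliams identity makes the enumerator invariant under a reflection of \<open>(x, y, z)\<close>, and
  evenness makes it invariant under \<open>y \<mapsto> - y\<close>.  Both reflections permute the three linear forms
  \<open>u = x + y\<close>, \<open>v = x - y\<close>, \<open>w = 2 z\<close>, and together they generate all their permutations.  Up to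
  a power of 2 the enumerator is the sum of the terms \<open>(u + v)\<^sup>k (u - v)\<^sup>2\<^sup>j w\<^sup>m\<close>, in which
  \<open>u + v = e\<^sub>1 - w\<close> and \<open>(u - v)\<^sup>2 = e\<^sub>1\<^sup>2 - 4 e\<^sub>2 + 2 e\<^sub>1 w - 3 w\<^sup>2\<close>.  Thus it is a polynomial in \<open>w\<close>
  with symmetric coefficients, and averaging over the three choices of \<open>w\<close> leaves only power sums
  of \<open>u, v, w\<close>, which Newton's recurrence expresses by \<open>e\<^sub>1, e\<^sub>2, e\<^sub>3\<close>.
\<close>

section \<open>The MacWilliams identity\<close>

text \<open>The nontrivial additive character of F_2. It takes integer values, so
  \<open>of_int\<close> carries it into every commutative ring.\<close>

definition sgn_bit :: "bit \<Rightarrow> int" where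
  "sgn_bit b = (if b = 0 then 1 else - 1)"

lemma sgn_bit_add: "sgn_bit (a + b) = sgn_bit a * sgn_bit b"
  by (cases a; cases b) (simp_all add: sgn_bit_def)

lemma sgn_bit_sum: "sgn_bit (sum f A) = (\<Prod>i\<in>A. sgn_bit (f i))"
proof -
  have "sgn_bit 0 = 1" by (simp add: sgn_bit_def)
  then show ?thesis
    by (induction A rule: infinite_finite_induct)
      (simp_all only: sum.infinite prod.infinite sum.empty prod.empty sum.insert prod.insert
        sgn_bit_add not_False_eq_True)
qed

lemma UNIV_klein: "(UNIV :: klein set) = {0, kone, komega, komegabar}"
proof -
  have "(a, b) \<in> {0, kone, komega, komegabar}" for a b :: bit
    by (cases a; cases b) (simp_all add: kone_def komega_def komegabar_def zero_prod_def)
  then show ?thesis by auto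
qed

lemma klein_distinct [simp]:
  "kone \<noteq> 0" "komega \<noteq> 0" "komegabar \<noteq> 0" "kone \<noteq> komega" "kone \<noteq> komegabar" "komega \<noteq> komegabar"
  "0 \<noteq> kone" "0 \<noteq> komega" "0 \<noteq> komegabar" "komega \<noteq> kone" "komegabar \<noteq> kone" "komegabar \<noteq> komega"
  by (simp_all add: kone_def komega_def komegabar_def zero_prod_def)

lemma qf_Pair: "qf (a, b) = a * b"
  by (cases a; cases b) (simp_all add: qf_def norm2_def kone_def zero_prod_def)

text \<open>In these coordinates \<open>qf\<close> is the hyperbolic form ab, and its polarization
  is visibly biadditive.\<close>

lemma kdot_Pair: "kdot (a, b) (c, d) = a * d + b * c"
  by (cases a; cases b; cases c; cases d) (simp_all add: kdot_def qf_Pair)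

lemma kdot_add_right: "kdot a (b + c) = kdot a b + kdot a c"
  by (cases a; cases b; cases c) (simp only: kdot_Pair add_Pair distrib_left ac_simps)

lemma ip_add_right: "ip x (y + z) = ip x y + ip x z"
  by (simp only: ip_def vector_add_component kdot_add_right sum.distrib)

text \<open>Orthogonality of characters: if some codeword e pairs with d to 1, translation by e
  permutes C and flips every sign, so the sum equals its own negative.\<close>

lemma sum_sgn_ip:
  fixes C :: "(klein ^ 'n) set"
  assumes "L_code C"
  shows "(\<Sum>c\<in>C. sgn_bit (ip d c)) = (if \<forall>c\<in>C. ip d c = 0 then int (card C) else 0)"
proof (cases "\<forall>c\<in>C. ip d c = 0")
  case True
  then show ?thesis by (simp add: sgn_bit_def)
next
  case False
  then obtain e where e: "e \<in> C" "ip d e \<noteq> 0" by blast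
  have "(\<Sum>c\<in>C. sgn_bit (ip d c)) = (\<Sum>c\<in>C. sgn_bit (ip d (c + e)))"
    by (rule sum.reindex_bij_witness[where i = "\<lambda>c. c + e" and j = "\<lambda>c. c - e"])
      (use assms e in \<open>auto simp: L_code_def diff_conv_add_uminus simp del: add_uminus_conv_diff\<close>)
  also have "\<dots> = - (\<Sum>c\<in>C. sgn_bit (ip d c))"
    unfolding ip_add_right sgn_bit_add using e by (simp add: sgn_bit_def[of 1] sum_negf)
  finally show ?thesis unfolding if_not_P[OF False] by linarith
qed

lemma prod_sum_vec:
  fixes f :: "'n::finite \<Rightarrow> 'b::finite \<Rightarrow> 'a::comm_semiring_1"
  shows "(\<Prod>i\<in>UNIV. \<Sum>b\<in>UNIV. f i b) = (\<Sum>d\<in>UNIV. \<Prod>i\<in>UNIV. f i (d $ i))"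
proof -
  have "(\<Prod>i\<in>UNIV. \<Sum>b\<in>UNIV. f i b) = (\<Sum>g\<in>PiE UNIV (\<lambda>_. UNIV). \<Prod>i\<in>UNIV. f i (g i))"
    by (rule prod_sum_PiE) auto
  also have "\<dots> = (\<Sum>d\<in>UNIV. \<Prod>i\<in>UNIV. f i (d $ i))"
    by (rule sum.reindex_bij_witness[where i = vec_nth and j = vec_lambda]) auto
  finally show ?thesis .
qed

text \<open>Poisson summation: the product expands into a sum over all of L^n, and after exchanging
  the sums orthogonality keeps exactly the vectors of the dual.\<close>

lemma macwilliams:
  fixes C :: "(klein ^ 'n) set" and f :: "klein \<Rightarrow> 'a::comm_ring_1"
  assumes "L_code C"
  shows "(\<Sum>c\<in>C. \<Prod>i\<in>UNIV. \<Sum>b\<in>UNIV. of_int (sgn_bit (kdot b (c $ i))) * f b) =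
    of_nat (card C) * (\<Sum>d | \<forall>c\<in>C. ip d c = 0. \<Prod>i\<in>UNIV. f (d $ i))"
proof -
  have "(\<Sum>c\<in>C. \<Prod>i\<in>UNIV. \<Sum>b\<in>UNIV. of_int (sgn_bit (kdot b (c $ i))) * f b) =
      (\<Sum>c\<in>C. \<Sum>d\<in>UNIV. of_int (sgn_bit (ip d c)) * (\<Prod>i\<in>UNIV. f (d $ i)))"
    by (simp add: prod_sum_vec prod.distrib ip_def sgn_bit_sum)
  also have "\<dots> = (\<Sum>d\<in>UNIV. of_int (\<Sum>c\<in>C. sgn_bit (ip d c)) * (\<Prod>i\<in>UNIV. f (d $ i)))"
    by (subst sum.swap) (simp add: sum_distrib_right)
  also have "\<dots> = (\<Sum>d\<in>UNIV. if \<forall>c\<in>C. ip d c = 0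
      then of_nat (card C) * (\<Prod>i\<in>UNIV. f (d $ i)) else 0)"
    by (rule sum.cong) (simp_all add: sum_sgn_ip[OF assms])
  also have "\<dots> = of_nat (card C) * (\<Sum>d | \<forall>c\<in>C. ip d c = 0. \<Prod>i\<in>UNIV. f (d $ i))"
    by (simp add: sum.If_cases sum_distrib_left)
  finally show ?thesis .
qed

section \<open>The symmetrized weight enumerator\<close>

text \<open>Values in an arbitrary commutative ring allow integers, for counting C, as well as
  polynomials.\<close>

definition swe_at :: "(klein ^ 'n) set \<Rightarrow> 'a \<Rightarrow> 'a \<Rightarrow> 'a \<Rightarrow> 'a::comm_ring_1" where
  "swe_at C x y z = (\<Sum>c\<in>C. x ^ n0 c * y ^ n1 c * z ^ n2 c)"

definition klein_fun :: "'a \<Rightarrow> 'a \<Rightarrow> 'a \<Rightarrow> klein \<Rightarrow> 'a" where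
  "klein_fun x y z b = (if b = 0 then x else if b = kone then y else z)"

lemma prod_klein_fun:
  fixes c :: "klein ^ 'n" and x y z :: "'a::comm_ring_1"
  shows "(\<Prod>i\<in>UNIV. klein_fun x y z (c $ i)) = x ^ n0 c * y ^ n1 c * z ^ n2 c"
proof -
  have split: "klein_fun x y z b = (if b = 0 then x else 1) * (if b = kone then y else 1) *
      (if b = komega \<or> b = komegabar then z else 1)" for b
    using UNIV_klein by (auto simp: klein_fun_def)
  show ?thesis
    by (simp add: split prod.distrib prod.If_cases n0_def n1_def n2_def)
qed

text \<open>The transform preserves the property of agreeing on \<open>komega\<close> and
  \<open>komegabar\<close>, so it acts on triples (x, y, z).\<close>

lemma sum_klein_fun:
  fixes x y z :: "'a::comm_ring_1"
  shows "(\<Sum>b\<in>UNIV. of_int (sgn_bit (kdot b a)) * klein_fun x y z b) =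
    klein_fun (x + y + 2 * z) (x + y - 2 * z) (x - y) a"
proof -
  have "a \<in> {0, kone, komega, komegabar}" using UNIV_klein by blast
  then show ?thesis
    by (auto simp: UNIV_klein klein_fun_def)
      (simp_all add: kone_def komega_def komegabar_def zero_prod_def kdot_Pair sgn_bit_def)
qed

lemma swe_at_macwilliams:
  fixes C :: "(klein ^ 'n) set" and x y z :: "'a::comm_ring_1"
  assumes "L_code C" "self_dual C"
  shows "swe_at C (x + y + 2 * z) (x + y - 2 * z) (x - y) = of_nat (card C) * swe_at C x y z"
  using macwilliams[OF assms(1), of "klein_fun x y z"] assms(2)
  by (simp add: sum_klein_fun prod_klein_fun swe_at_def self_dual_def)

lemma n0_n1_n2:
  fixes c :: "klein ^ 'n"
  shows "n0 c + n1 c + n2 c = CARD('n)"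
proof -
  have "UNIV = ({i. c $ i = 0} \<union> {i. c $ i = kone}) \<union> {i. c $ i = komega \<or> c $ i = komegabar}"
    using UNIV_klein by auto
  moreover have "card (({i. c $ i = 0} \<union> {i. c $ i = kone}) \<union>
      {i. c $ i = komega \<or> c $ i = komegabar}) = n0 c + n1 c + n2 c"
    unfolding n0_def n1_def n2_def by (subst card_Un_disjoint; auto)+
  ultimately show ?thesis by simp
qed

lemma ewt_n1_n2: "ewt c = n1 c + 2 * n2 c"
proof -
  have "norm2 b = (if b = kone then 1 else 0) + (if b = komega \<or> b = komegabar then 2 else 0)" for b
    using UNIV_klein by (auto simp: norm2_def)
  then show ?thesis
    by (simp add: ewt_def sum.distrib sum.If_cases n1_def n2_def)
qed

lemma swe_at_scale:
  fixes C :: "(klein ^ 'n) set"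
  shows "swe_at C (a * x) (a * y) (a * z) = a ^ CARD('n) * swe_at C x y z"
  unfolding swe_at_def sum_distrib_left
proof (rule sum.cong)
  fix c :: "klein ^ 'n"
  show "(a * x) ^ n0 c * (a * y) ^ n1 c * (a * z) ^ n2 c =
      a ^ CARD('n) * (x ^ n0 c * y ^ n1 c * z ^ n2 c)"
    unfolding n0_n1_n2[of c, symmetric] by (simp add: power_add power_mult_distrib ac_simps)
qed simp

text \<open>The Euclidean weight is n1 + 2 n2, so it has the parity of n1.\<close>

lemma swe_at_uminus:
  assumes "even_code C"
  shows "swe_at C x (- y) z = swe_at C x y z"
proof -
  have "even (n1 c)" if "c \<in> C" for c
    using assms that by (auto simp: even_code_def ewt_n1_n2)
  then show ?thesis by (simp add: swe_at_def)
qed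

lemma card_self_dual:
  fixes C :: "(klein ^ 'n) set"
  assumes "L_code C" "self_dual C"
  shows "card C = 2 ^ CARD('n)"
proof -
  \<comment> \<open>\<open>(3, 1, 1)\<close> is an eigenvector, with eigenvalue 2, of the MacWilliams transform.\<close>
  have "int (card C) * swe_at C 3 1 1 = 2 ^ CARD('n) * swe_at C 3 1 1"
    using swe_at_macwilliams[OF assms, of 3 1 "1::int"] swe_at_scale[of C 2 3 "1::int" 1] by simp
  moreover have "swe_at C 3 1 1 > (0::int)"
    using assms(1) by (auto simp: swe_at_def L_code_def intro!: sum_pos)
  ultimately have "int (card C) = int (2 ^ CARD('n))" by simp
  then show ?thesis by (simp only: of_nat_eq_iff)
qed

text \<open>In the coordinates u, v, w the MacWilliams transform is, up to the scalar 2, the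
  exchange of v and w. The factors 2^n stay because 2 may be a zero divisor in the ring.\<close>

lemma swe_at_swap:
  fixes C :: "(klein ^ 'n) set" and u v w :: "'a::comm_ring_1"
  assumes "L_code C" "self_dual C"
  shows "2 ^ CARD('n) * swe_at C (u + v) (u - v) w = 2 ^ CARD('n) * swe_at C (u + w) (u - w) v"
proof -
  have "2 ^ CARD('n) * swe_at C (u + v) (u - v) w =
      swe_at C (u + v + (u - v) + 2 * w) (u + v + (u - v) - 2 * w) (u + v - (u - v))"
    by (simp only: swe_at_macwilliams[OF assms] card_self_dual[OF assms]) simp
  also have "\<dots> = swe_at C (2 * (u + w)) (2 * (u - w)) (2 * v)"
    by (simp add: algebra_simps)
  finally show ?thesis by (simp only: swe_at_scale)
qed

section \<open>Weighted homogeneous polynomials in three given polynomials\<close>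

lemma pconst_add: "pconst (a + b) = pconst a + pconst b"
  by (simp add: pconst_def single_add)

lemma pconst_mult: "pconst (a * b) = pconst a * pconst b"
  by (simp add: pconst_def mult_single)

lemma pconst_0 [simp]: "pconst 0 = 0"
  by (simp add: pconst_def)

lemma pconst_1 [simp]: "pconst 1 = 1"
  by (simp add: pconst_def)

lemma pconst_of_nat: "pconst (of_nat k) = of_nat k"
  by (induction k) (simp_all add: pconst_add)

lemma pconst_numeral: "pconst (numeral k) = numeral k"
  using pconst_of_nat[of "numeral k"] by simp

text \<open>Zero coefficients contribute nothing, so substitutions into different polynomials can be
  summed over a common index set.\<close>

lemma poly3_subst_superset:
  assumes "finite A" "Poly_Mapping.keys F \<subseteq> A"
  shows "poly3_subst F p q r =
    (\<Sum>(i, j, k)\<in>A. pconst (Poly_Mapping.lookup F (i, j, k)) * p ^ i * q ^ j * r ^ k)"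
  unfolding poly3_subst_def
  by (rule sum.mono_neutral_left) (use assms in \<open>auto simp: in_keys_iff\<close>)

lemma poly3_subst_add: "poly3_subst (F + G) p q r = poly3_subst F p q r + poly3_subst G p q r"
proof -
  let ?A = "Poly_Mapping.keys F \<union> Poly_Mapping.keys G"
  have *: "finite ?A" "Poly_Mapping.keys (F + G) \<subseteq> ?A" "Poly_Mapping.keys F \<subseteq> ?A"
    "Poly_Mapping.keys G \<subseteq> ?A"
    using keys_add[of F G] by simp_all
  show ?thesis
    unfolding poly3_subst_superset[OF *(1,2)] poly3_subst_superset[OF *(1,3)]
      poly3_subst_superset[OF *(1,4)] sum.distrib[symmetric]
    by (rule sum.cong) (auto simp: lookup_add pconst_add algebra_simps)
qed

text \<open>The weighted degree n part of the algebra generated by p, q, r over the rationals. The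
  representing polynomial stays hidden, so closure properties need no arithmetic with it.\<close>

inductive wform :: "poly3 \<Rightarrow> poly3 \<Rightarrow> poly3 \<Rightarrow> nat \<Rightarrow> poly3 \<Rightarrow> bool" for p q r where
  monom: "i + 2 * j + 3 * k = n \<Longrightarrow> wform p q r n (pconst a * p ^ i * q ^ j * r ^ k)"
| add: "wform p q r n f \<Longrightarrow> wform p q r n g \<Longrightarrow> wform p q r n (f + g)"

lemma wform_imp_poly3_subst:
  "wform p q r n f \<Longrightarrow> \<exists>F. weighted_homogeneous 1 2 3 n F \<and> f = poly3_subst F p q r"
proof (induction rule: wform.induct)
  case (monom i j k n a)
  let ?F = "Poly_Mapping.single (i, j, k) a :: poly3"
  have "weighted_homogeneous 1 2 3 n ?F"
    using monom by (simp add: weighted_homogeneous_def)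
  moreover have "poly3_subst ?F p q r = pconst a * p ^ i * q ^ j * r ^ k"
    \<comment> \<open>The superset form also covers a = 0, where \<open>?F\<close> has no
      keys.\<close>
    by (subst poly3_subst_superset[of "{(i, j, k)}"]) simp_all
  ultimately show ?case by metis
next
  case (add n f g)
  then obtain F G where "weighted_homogeneous 1 2 3 n F" "f = poly3_subst F p q r"
    "weighted_homogeneous 1 2 3 n G" "g = poly3_subst G p q r" by blast
  moreover from this have "weighted_homogeneous 1 2 3 n (F + G)"
    using keys_add[of F G] by (fastforce simp: weighted_homogeneous_def)
  ultimately show ?case using poly3_subst_add by metis
qed

lemma wform_monom_mult:
  assumes "wform p q r n g" "i + 2 * j + 3 * k = m"
  shows "wform p q r (m + n) (pconst a * p ^ i * q ^ j * r ^ k * g)"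
  using assms
proof (induction rule: wform.induct)
  case (monom i' j' k' n a')
  have "wform p q r (m + n) (pconst (a * a') * p ^ (i + i') * q ^ (j + j') * r ^ (k + k'))"
    using monom by (intro wform.monom) simp
  then show ?case by (simp add: pconst_mult power_add ac_simps)
next
  case (add n f g)
  then show ?case by (simp add: distrib_left wform.add)
qed

lemma wform_mult: "wform p q r m f \<Longrightarrow> wform p q r n g \<Longrightarrow> wform p q r (m + n) (f * g)"
  by (induction rule: wform.induct) (simp_all add: wform_monom_mult distrib_right wform.add)

lemma wform_pconst: "wform p q r 0 (pconst a)"
  using wform.monom[of 0 0 0 0 p q r a] by simp

lemma wform_pconst_mult: "wform p q r n f \<Longrightarrow> wform p q r n (pconst a * f)"
  using wform_mult[OF wform_pconst] by fastforce

lemma wform_numeral_mult: "wform p q r n f \<Longrightarrow> wform p q r n (numeral k * f)"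
  using wform_pconst_mult[of p q r n f "numeral k"] by (simp add: pconst_numeral)

lemma wform_diff: "wform p q r n f \<Longrightarrow> wform p q r n g \<Longrightarrow> wform p q r n (f - g)"
proof -
  have "pconst (- 1) = - 1"
    using pconst_add[of 1 "- 1"] by (simp add: eq_neg_iff_add_eq_0 add.commute)
  then show "wform p q r n f \<Longrightarrow> wform p q r n g \<Longrightarrow> wform p q r n (f - g)"
    using wform.add[of p q r n f "pconst (- 1) * g"] wform_pconst_mult[of p q r n g "- 1"] by simp
qed

lemma wform_0: "wform p q r n 0"
  using wform.monom[of n 0 0 n p q r 0] by simp

lemma wform_sum: "(\<And>c. c \<in> A \<Longrightarrow> wform p q r n (f c)) \<Longrightarrow> wform p q r n (sum f A)"
  by (induction A rule: infinite_finite_induct) (simp_all add: wform_0 wform.add)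

text \<open>This is where rational coefficients enter.\<close>

lemma wform_of_nat_mult_cancel:
  assumes "wform p q r n (of_nat k * f)" "k > 0"
  shows "wform p q r n f"
proof -
  have "pconst (1 / of_nat k) * (of_nat k * f) = pconst (1 / of_nat k * of_nat k) * f"
    by (simp only: pconst_mult pconst_of_nat mult.assoc)
  also have "\<dots> = f" using assms(2) by simp
  finally show ?thesis using wform_pconst_mult[OF assms(1), of "1 / of_nat k"] by simp
qed

lemma wform_vars: "wform p q r 1 p" "wform p q r 2 q" "wform p q r 3 r"
  using wform.monom[of 1 0 0 1 p q r 1] wform.monom[of 0 1 0 2 p q r 1]
    wform.monom[of 0 0 1 3 p q r 1] by simp_all

section \<open>Symmetric functions of three forms\<close>

locale elementary_wforms =
  fixes p q r u v w :: poly3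
  assumes wform_e1: "wform p q r 1 (u + v + w)"
    and wform_e2: "wform p q r 2 (u * v + v * w + w * u)"
    and wform_e3: "wform p q r 3 (u * v * w)"
begin

text \<open>Newton's recurrence s_m = e1 s_(m-1) - e2 s_(m-2) + e3 s_(m-3) for m at least 3; the
  cases below 3 are direct, with s_0 = 3.\<close>

lemma wform_power_sum: "wform p q r m (u ^ m + v ^ m + w ^ m)"
proof (induction m rule: less_induct)
  case (less m)
  consider "m = 0" | "m = 1" | "m = 2" | k where "m = 3 + k"
    by (metis One_nat_def Suc_1 add.commute le_Suc_ex less_2_cases not_less_eq_eq
        numeral_3_eq_3 verit_comp_simplify1(3) le_antisym)
  then show ?case
  proof cases
    case 1
    then show ?thesis using wform_pconst[of p q r 3] by (simp add: pconst_numeral)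
  next
    case 2
    then show ?thesis using wform_e1 by simp
  next
    case 3
    have "wform p q r (1 + 1) ((u + v + w) * (u + v + w))"
      by (intro wform_mult wform_e1)
    then have "wform p q r 2 ((u + v + w) * (u + v + w) - 2 * (u * v + v * w + w * u))"
      by (intro wform_diff wform_numeral_mult wform_e2) (simp add: numeral_2_eq_2)
    then show ?thesis using 3 by (simp add: algebra_simps power2_eq_square)
  next
    case (4 k)
    let ?s = "\<lambda>m. u ^ m + v ^ m + w ^ m"
    have "wform p q r m ((u + v + w) * ?s (2 + k))"
      "wform p q r m ((u * v + v * w + w * u) * ?s (1 + k))"
      "wform p q r m ((u * v * w) * ?s k)"
      using wform_mult[OF wform_e1 less[of "2 + k"]] wform_mult[OF wform_e2 less[of "1 + k"]]
        wform_mult[OF wform_e3 less[of k]] 4 by (simp_all add: numeral_eq_Suc)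
    then have "wform p q r m ((u + v + w) * ?s (2 + k) - (u * v + v * w + w * u) * ?s (1 + k) +
        (u * v * w) * ?s k)"
      by (intro wform.add wform_diff)
    also have "(u + v + w) * ?s (2 + k) - (u * v + v * w + w * u) * ?s (1 + k) +
        (u * v * w) * ?s k = ?s m"
      using 4 by (simp add: power_add power2_eq_square power3_eq_cube algebra_simps)
    finally show ?thesis .
  qed
qed

text \<open>Each induction step trades one factor a + b, or one factor (a - b)^2, for powers of c
  with symmetric coefficients. The exponent m grows by up to 2, hence it is kept arbitrary; at k = j
  = 0 power sums remain.\<close>

lemma wform_cyclic_sum_aux:
  defines "g \<equiv> (\<lambda>m k j a b c. c ^ m * (a + b) ^ k * (a - b) ^ (2 * j))"
  shows "wform p q r (m + k + 2 * j) (g m k j u v w + g m k j v w u + g m k j w u v)"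
proof (induction j arbitrary: m k)
  case 0
  show ?case
  proof (induction k arbitrary: m)
    case 0
    show ?case using wform_power_sum[of m] by (simp add: g_def ac_simps)
  next
    case (Suc k)
    let ?S = "\<lambda>m. g m k 0 u v w + g m k 0 v w u + g m k 0 w u v"
    have "wform p q r (m + Suc k) ((u + v + w) * ?S m - ?S (Suc m))"
      using wform_diff[OF wform_mult[OF wform_e1 Suc[of m]]] Suc[of "Suc m"] by simp
    also have "(u + v + w) * ?S m - ?S (Suc m) =
        g m (Suc k) 0 u v w + g m (Suc k) 0 v w u + g m (Suc k) 0 w u v"
      by (simp add: g_def algebra_simps)
    finally show ?case by simp
  qed
next
  case (Suc j)
  let ?S = "\<lambda>m. g m k j u v w + g m k j v w u + g m k j w u v"
  let ?e1 = "u + v + w" and ?e2 = "u * v + v * w + w * u"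
  have "wform p q r (1 + (1 + (m + k + 2 * j))) (?e1 * (?e1 * ?S m))"
    "wform p q r (2 + (m + k + 2 * j)) (4 * (?e2 * ?S m))"
    "wform p q r (1 + (Suc m + k + 2 * j)) (2 * (?e1 * ?S (Suc m)))"
    "wform p q r (Suc (Suc m) + k + 2 * j) (3 * ?S (Suc (Suc m)))"
    by (intro wform_numeral_mult wform_mult wform_e1 wform_e2 Suc)+
  then have "wform p q r (m + k + 2 * Suc j) (?e1 * (?e1 * ?S m) - 4 * (?e2 * ?S m) +
      2 * (?e1 * ?S (Suc m)) - 3 * ?S (Suc (Suc m)))"
    by (intro wform_diff wform.add) simp_all
  also have "?e1 * (?e1 * ?S m) - 4 * (?e2 * ?S m) + 2 * (?e1 * ?S (Suc m)) - 3 * ?S (Suc (Suc m)) =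
      g m k (Suc j) u v w + g m k (Suc j) v w u + g m k (Suc j) w u v"
  proof -
    \<comment> \<open>From (a - b)^2 = (a + b)^2 - 4ab, with a + b = e1 - c and ab = e2 - c (e1 -
      c).\<close>
    have step: "(a - b) ^ (2 * Suc j) = (?e1 * ?e1 - 4 * ?e2 + 2 * ?e1 * c - 3 * c * c) * (a - b) ^ (2 * j)"
      if "a + b + c = ?e1" "a * b + b * c + c * a = ?e2" for a b c :: poly3
      unfolding that[symmetric] by (simp add: algebra_simps)
    have "g m k (Suc j) a b c = ?e1 * (?e1 * g m k j a b c) - 4 * (?e2 * g m k j a b c) +
        2 * (?e1 * g (Suc m) k j a b c) - 3 * g (Suc (Suc m)) k j a b c"
      if "a + b + c = ?e1" "a * b + b * c + c * a = ?e2" for a b c :: poly3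
      unfolding g_def step[OF that] by (simp add: algebra_simps)
    from this[of u v w] this[of v w u] this[of w u v] show ?thesis
      by (simp add: ac_simps) (simp add: algebra_simps)
  qed
  finally show ?case .
qed

lemma wform_cyclic_sum:
  assumes "even l" "k + l + m = n"
  shows "wform p q r n ((u + v) ^ k * (u - v) ^ l * w ^ m + (v + w) ^ k * (v - w) ^ l * u ^ m +
    (w + u) ^ k * (w - u) ^ l * v ^ m)"
proof -
  obtain j where "l = 2 * j" using assms(1) by blast
  then show ?thesis
    using wform_cyclic_sum_aux[of m k j] assms(2) by (auto simp: ac_simps)
qed

end

section \<open>The enumerator in the coordinates u, v, w\<close>

theorem theorem4p3:
  fixes C :: "(klein ^ 'n) set"
  assumes "L_code C" and "self_dual C" and "even_code C"
  shows "\<exists>F :: poly3. weighted_homogeneous 1 2 3 CARD('n) F \<and>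
    swe C = poly3_subst F
      (var1 + var3)
      (var1^2 + var2^2 + 2 * var3^2)
      (var1^3 + 3 * var1 * var3^2 + 3 * var2^2 * var3 + var3^3)"
proof -
  define x y z where "x = var1" and "y = var2" and "z = var3"
  define p where "p = x + z"
  define q where "q = x^2 + y^2 + 2 * z^2"
  define r where "r = x^3 + 3 * x * z^2 + 3 * y^2 * z + z^3"
  define u v w where "u = x + y" and "v = x - y" and "w = 2 * z"
  let ?N = "CARD('n)"
  have p_powers: "wform p q r 2 (p * p)" "wform p q r 3 (p * p * p)"
    using wform.monom[of 2 0 0 2 p q r 1] wform.monom[of 3 0 0 3 p q r 1]
    by (simp_all add: power2_eq_square power3_eq_cube)
  interpret elementary_wforms p q r u v w
  proof
    have "u + v + w = 2 * p"
      by (simp add: u_def v_def w_def p_def)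
    then show "wform p q r 1 (u + v + w)"
      by (metis wform_numeral_mult wform_vars(1))
    have "u * v + v * w + w * u = 2 * (p * p) - q"
      by (simp add: u_def v_def w_def p_def q_def power2_eq_square algebra_simps)
    then show "wform p q r 2 (u * v + v * w + w * u)"
      by (metis wform_numeral_mult wform_vars(2) wform_diff p_powers(1))
    \<comment> \<open>Only 3 uvw is an integral combination of p^3 and r, so the 3 must be divided
      out.\<close>
    have "of_nat 3 * (u * v * w) = 2 * (p * p * p - r)"
      by (simp add: u_def v_def w_def p_def r_def power2_eq_square power3_eq_cube algebra_simps)
    then have "wform p q r 3 (of_nat 3 * (u * v * w))"
      by (metis wform_numeral_mult wform_vars(3) wform_diff p_powers(2))
    then show "wform p q r 3 (u * v * w)"
      by (rule wform_of_nat_mult_cancel) simp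
  qed
  let ?G = "\<lambda>a b c. swe_at C (a + b) (a - b) c"
  \<comment> \<open>The sign change of y exchanges the first two arguments; combined with
    \<open>swe_at_swap\<close> it yields the cyclic rotations.\<close>
  have comm: "?G a b c = ?G b a c" for a b c :: poly3
    using swe_at_uminus[OF assms(3), of "a + b" "a - b" c] by (simp add: add.commute)
  have G1: "2 ^ ?N * ?G v w u = 2 ^ ?N * ?G u v w"
    using swe_at_swap[OF assms(1,2), of v w u] by (simp only: comm[of v u])
  have G2: "2 ^ ?N * ?G w u v = 2 ^ ?N * ?G u v w"
    using swe_at_swap[OF assms(1,2), of u w v] by (simp only: comm[of w u])
  have swe: "2 ^ ?N * swe C = ?G u v w"
    using swe_at_scale[of C 2 x y z]
    by (simp add: u_def v_def w_def x_def y_def z_def swe_at_def swe_def)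
  \<comment> \<open>Codeword by codeword, \<open>wform_cyclic_sum\<close> applies with exponents n0,
    n1, n2, where n1 is even.\<close>
  have "wform p q r ?N (?G u v w + ?G v w u + ?G w u v)"
    unfolding swe_at_def sum.distrib[symmetric]
    using assms(3) n0_n1_n2
    by (intro wform_sum wform_cyclic_sum) (auto simp: even_code_def ewt_n1_n2)
  then have "wform p q r ?N (pconst (2 ^ ?N) * (?G u v w + ?G v w u + ?G w u v))"
    by (rule wform_pconst_mult)
  moreover have "pconst (2 ^ ?N) = 2 ^ ?N"
    using pconst_of_nat[of "2 ^ ?N"] by simp
  \<comment> \<open>The 3 counts the rotations; one power of 2 comes from
    \<open>swe_at_swap\<close>, the other from the arguments 2x, 2y, 2z.\<close>
  moreover have "2 ^ ?N * (?G u v w + ?G v w u + ?G w u v) = of_nat (3 * 2 ^ ?N * 2 ^ ?N) * swe C"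
    unfolding distrib_left G1 G2 by (simp add: swe[symmetric] algebra_simps)
  ultimately have "wform p q r ?N (of_nat (3 * 2 ^ ?N * 2 ^ ?N) * swe C)"
    by simp
  then have "wform p q r ?N (swe C)"
    by (rule wform_of_nat_mult_cancel) simp
  then show ?thesis
    using wform_imp_poly3_subst unfolding p_def q_def r_def x_def y_def z_def by blast
qed

end
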